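(* Let $\|\cdot\|$ be a norm on $\mathbb{R}^d$ and let $f$ be a convex function with a minimizer $x^\ast$ whose $q$-th derivative is $(L,\nu)$-H\"older continuous with respect to $\|\cdot\|$ ($q\ge1$ an integer, $\nu\in(0,1]$, $L>0$). Consider the algorithm that sequentially iterates $(x_{k+1},v_k)\leftarrow\mathcal{O}_r(x_k,\lambda)$, where $\mathcal{O}_r$ is the inexact proximal oracle described in the context, $r=q+\nu$ and $\lambda=1/L$. Let $R=\max_{k\in\{1,\dots,T\}}\|x_k-x^\ast\|$ (any upper bound on this quantity works as well). After $T+1$ iterations, the algorithm satisfies $$f(x_{T+1})-f(x^\ast)=O_{q+\nu}\!\left(\frac{LR^{q+\nu}}{T^{q+\nu-1}}\right).$$
   Context: $O_{q+\nu}(\cdot)$ omits factors depending on $q+\nu$. The $q$-th derivative of $f$ is $(L,\nu)$-H\"older continuous if $\|\nabla^qf(x)-\nabla^qf(y)\|_\ast\le L\|x-y\|^\nu$ for all $x,y$, where $\|F\|_\ast=\max_{\|v\|\le1}|F[v]^{\otimes q}|$ for a $q$-linear form $F$. For $\gamma\ge0$, $\partial^\gamma f(y)=\{g:f(z)\ge f(y)+\langle g,z-y\rangle-\gamma\ \forall z\}$. Inexact proximal oracle: given $\sigma,\sigma'\in[0,1/2)$, $(y,v)\leftarrow\mathcal{O}_r(x,\lambda)$ returns a point $y$ and $v\in\partial^{\varepsilon}f(y)$ such that $$\|v-\hat v\|_\ast\le\tfrac\sigma\lambda\|x-y\|^{r-1}\ \text{ for some }\hat v\in\partial_z\big(-\tfrac1{r\lambda}\|z-x\|^r\big)(y),\qquad\varepsilon\le\tfrac{\sigma'}\lambda\|x-y\|^r,$$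 where $\|\cdot\|_\ast$ on vectors is the dual norm and $\partial(-\phi)$ means $-\partial\phi$ for convex $\phi$.
   Formalization: The hidden constant may depend on the oracle accuracies σ, σ' as well as on q+ν; a constant uniform over all σ, σ' in [0,1/2) is impossible (f(x)=Lx²/2 on the line, q=ν=1, σ=σ' tending to 1/2). *)

theory Defs
  imports Complex_Main "Jordan_Normal_Form.Matrix"
begin

text \<open>
  The constant hidden in an asymptotic bound must not depend on the dimension, so the dimension is
  a term: the space of dimension \<open>d\<close> is \<^term>\<open>carrier_vec d :: real vec set\<close>, and norms, functions
  and forms on it are HOL functions whose values outside the carrier are irrelevant.
\<close>

definition is_norm :: "nat \<Rightarrow> (real vec \<Rightarrow> real) \<Rightarrow> bool" where
  "is_norm d nrm \<longleftrightarrow>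
     (\<forall>x\<in>carrier_vec d. 0 \<le> nrm x) \<and>
     (\<forall>x\<in>carrier_vec d. nrm x = 0 \<longrightarrow> x = 0\<^sub>v d) \<and>
     (\<forall>c. \<forall>x\<in>carrier_vec d. nrm (c \<cdot>\<^sub>v x) = \<bar>c\<bar> * nrm x) \<and>
     (\<forall>x\<in>carrier_vec d. \<forall>y\<in>carrier_vec d. nrm (x + y) \<le> nrm x + nrm y)"

definition convex_fun :: "nat \<Rightarrow> (real vec \<Rightarrow> real) \<Rightarrow> bool" where
  "convex_fun d f \<longleftrightarrow>
     (\<forall>x\<in>carrier_vec d. \<forall>y\<in>carrier_vec d. \<forall>t\<in>{0..1}.
        f ((1 - t) \<cdot>\<^sub>v x + t \<cdot>\<^sub>v y) \<le> (1 - t) * f x + t * f y)"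

definition is_minimizer :: "nat \<Rightarrow> (real vec \<Rightarrow> real) \<Rightarrow> real vec \<Rightarrow> bool" where
  "is_minimizer d f x \<longleftrightarrow> x \<in> carrier_vec d \<and> (\<forall>z\<in>carrier_vec d. f x \<le> f z)"

definition is_linear_form :: "nat \<Rightarrow> (real vec \<Rightarrow> real) \<Rightarrow> bool" where
  "is_linear_form d G \<longleftrightarrow>
     (\<forall>x\<in>carrier_vec d. \<forall>y\<in>carrier_vec d. G (x + y) = G x + G y) \<and>
     (\<forall>c. \<forall>x\<in>carrier_vec d. G (c \<cdot>\<^sub>v x) = c * G x)"

text \<open>
  Frechet derivative. All norms on a finite-dimensional space are equivalent, so the notion
  does not depend on which norm is supplied.
\<close>

definition has_frechet_deriv ::
  "nat \<Rightarrow> (real vec \<Rightarrow> real) \<Rightarrow> (real vec \<Rightarrow> real) \<Rightarrow> (real vec \<Rightarrow> real) \<Rightarrow> real vec \<Rightarrow> bool" where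
  "has_frechet_deriv d nrm g G x \<longleftrightarrow>
     is_linear_form d G \<and>
     (\<forall>e>0. \<exists>\<delta>>0. \<forall>h\<in>carrier_vec d. nrm h < \<delta> \<longrightarrow>
        \<bar>g (x + h) - g x - G h\<bar> \<le> e * nrm h)"

text \<open>
  \<open>D k x [v\<^sub>1, \<dots>, v\<^sub>k]\<close> is the \<open>k\<close>-th derivative of \<open>f\<close> at \<open>x\<close>, a \<open>k\<close>-linear form, applied to
  \<open>v\<^sub>1, \<dots>, v\<^sub>k\<close>. The conditions determine it uniquely for \<open>k \<le> q\<close>. Differentiability of the form
  \<open>D k\<close> is imposed for each fixed list of arguments, which in finite dimension is the same as
  differentiability of \<open>D k\<close> as a map into the space of \<open>k\<close>-linear forms.
\<close>

definition derivatives_upto ::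
  "nat \<Rightarrow> (real vec \<Rightarrow> real) \<Rightarrow> (real vec \<Rightarrow> real) \<Rightarrow> nat
     \<Rightarrow> (nat \<Rightarrow> real vec \<Rightarrow> real vec list \<Rightarrow> real) \<Rightarrow> bool" where
  "derivatives_upto d nrm f q D \<longleftrightarrow>
     (\<forall>x\<in>carrier_vec d. D 0 x [] = f x) \<and>
     (\<forall>k<q. \<forall>x\<in>carrier_vec d. \<forall>vs. length vs = k \<and> set vs \<subseteq> carrier_vec d \<longrightarrow>
        has_frechet_deriv d nrm (\<lambda>y. D k y vs) (\<lambda>h. D (Suc k) x (h # vs)) x)"

text \<open>In the two dual norms below the supremum is a maximum, by compactness of the unit ball.\<close>

definition form_norm ::
  "nat \<Rightarrow> (real vec \<Rightarrow> real) \<Rightarrow> nat \<Rightarrow> (real vec list \<Rightarrow> real) \<Rightarrow> real" where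
  "form_norm d nrm q F = Sup {\<bar>F (replicate q v)\<bar> | v. v \<in> carrier_vec d \<and> nrm v \<le> 1}"

definition dual_norm :: "nat \<Rightarrow> (real vec \<Rightarrow> real) \<Rightarrow> real vec \<Rightarrow> real" where
  "dual_norm d nrm g = Sup {\<bar>g \<bullet> v\<bar> | v. v \<in> carrier_vec d \<and> nrm v \<le> 1}"

definition holder_deriv ::
  "nat \<Rightarrow> (real vec \<Rightarrow> real) \<Rightarrow> (real vec \<Rightarrow> real) \<Rightarrow> nat \<Rightarrow> real \<Rightarrow> real \<Rightarrow> bool" where
  "holder_deriv d nrm f q L \<nu> \<longleftrightarrow>
     (\<exists>D. derivatives_upto d nrm f q D \<and>
        (\<forall>x\<in>carrier_vec d. \<forall>y\<in>carrier_vec d.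
           form_norm d nrm q (\<lambda>vs. D q x vs - D q y vs) \<le> L * nrm (x - y) powr \<nu>))"

definition subdiff :: "nat \<Rightarrow> real \<Rightarrow> (real vec \<Rightarrow> real) \<Rightarrow> real vec \<Rightarrow> real vec set" where
  "subdiff d \<gamma> f y =
     {g \<in> carrier_vec d. \<forall>z\<in>carrier_vec d. f z \<ge> f y + g \<bullet> (z - y) - \<gamma>}"

text \<open>
  \<open>prox_oracle d nrm f r \<sigma> \<sigma>' x lam y v\<close>: the pair \<open>(y, v)\<close> is an admissible answer of the
  inexact proximal oracle of order \<open>r\<close> to the query \<open>(x, lam)\<close>. The vector \<open>w\<close> with
  \<open>w \<in> \<partial>(-\<phi>)(y) = -\<partial>\<phi>(y)\<close> for the convex \<open>\<phi>(z) = \<parallel>z - x\<parallel>\<^sup>r / (r lam)\<close> is \<^term>\<open>- g\<close> with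
  \<open>g\<close> in the exact subdifferential.
\<close>

definition prox_oracle ::
  "nat \<Rightarrow> (real vec \<Rightarrow> real) \<Rightarrow> (real vec \<Rightarrow> real) \<Rightarrow> real \<Rightarrow> real \<Rightarrow> real
     \<Rightarrow> real vec \<Rightarrow> real \<Rightarrow> real vec \<Rightarrow> real vec \<Rightarrow> bool" where
  "prox_oracle d nrm f r \<sigma> \<sigma>' x lam y v \<longleftrightarrow>
     y \<in> carrier_vec d \<and>
     (\<exists>\<epsilon>\<ge>0. v \<in> subdiff d \<epsilon> f y \<and> \<epsilon> \<le> \<sigma>' / lam * nrm (x - y) powr r) \<and>
     (\<exists>g\<in>subdiff d 0 (\<lambda>z. 1 / (r * lam) * nrm (z - x) powr r) y.
        dual_norm d nrm (v - (- g)) \<le> \<sigma> / lam * nrm (x - y) powr (r - 1))"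

end

theory Submission
  imports "HOL-Analysis.Function_Topology" Defs
begin

text \<open>
  Write \<open>D\<close> for the length of a step and \<open>c = 1 - \<sigma> - \<sigma>'\<close>, \<open>A = 1 + \<sigma>\<close>, \<open>p = r - 1\<close>. The
  subgradients of the power \<open>\<parallel>z - x\<parallel>\<^sup>r / (r \<lambda>)\<close> have dual norm at most \<open>D\<^sup>p / \<lambda>\<close> and pair with
  \<open>y - x\<close> to at least \<open>D\<^sup>r / \<lambda>\<close>, so a call from \<open>x\<close> to \<open>y\<close> satisfies
  \<open>f y - f z \<le> (A D\<^sup>p \<parallel>x - z\<parallel> - c D\<^sup>r) / \<lambda>\<close> for every \<open>z\<close>. Taking \<open>z = x\<close> shows that the value
  drops by \<open>c L D\<^sup>r\<close>; taking \<open>z = x\<^sup>*\<close> shows that \<open>D\<close> is large as long as the gap is large. The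
  two together give the rate by induction, and the second one alone bounds the gap after the
  first step from an iterate within distance \<open>R\<close> of the minimizer.
\<close>

section \<open>Norms on the carrier\<close>

lemma is_normD:
  assumes "is_norm d nrm"
  shows is_norm_nonneg: "x \<in> carrier_vec d \<Longrightarrow> 0 \<le> nrm x"
    and is_norm_eq_0: "x \<in> carrier_vec d \<Longrightarrow> nrm x = 0 \<Longrightarrow> x = 0\<^sub>v d"
    and is_norm_smult: "x \<in> carrier_vec d \<Longrightarrow> nrm (c \<cdot>\<^sub>v x) = \<bar>c\<bar> * nrm x"
    and is_norm_add: "x \<in> carrier_vec d \<Longrightarrow> y \<in> carrier_vec d \<Longrightarrow> nrm (x + y) \<le> nrm x + nrm y"
  using assms unfolding is_norm_def by blast+

lemma is_norm_zero:
  assumes "is_norm d nrm"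
  shows "nrm (0\<^sub>v d) = 0"
proof -
  have "0 \<cdot>\<^sub>v 0\<^sub>v d = (0\<^sub>v d :: real vec)"
    by (intro eq_vecI) auto
  then show ?thesis
    using is_norm_smult[OF assms zero_carrier_vec, of 0] by simp
qed

lemma is_norm_minus_commute:
  assumes "is_norm d nrm" "x \<in> carrier_vec d" "y \<in> carrier_vec d"
  shows "nrm (x - y) = nrm (y - x)"
proof -
  have "y - x = (- 1) \<cdot>\<^sub>v (x - y)"
    using assms by (intro eq_vecI) auto
  then show ?thesis
    using is_norm_smult[OF assms(1), of "x - y" "- 1"] assms by simp
qed

lemma is_norm_triangle_minus:
  assumes "is_norm d nrm" "x \<in> carrier_vec d" "y \<in> carrier_vec d" "z \<in> carrier_vec d"
  shows "nrm (x - z) \<le> nrm (x - y) + nrm (y - z)"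
proof -
  have "x - z = (x - y) + (y - z)"
    using assms by (intro eq_vecI) auto
  then show ?thesis
    using is_norm_add[OF assms(1), of "x - y" "y - z"] assms by simp
qed

text \<open>The triangle inequality along the expansion in the standard basis. Cutting the vector
  off at \<open>m\<close> lets the induction add one basis vector at a time; the case of interest is
  \<open>m = d\<close>.\<close>

lemma is_norm_le_sum_unit_vec:
  assumes "is_norm d nrm" "m \<le> d"
  shows "nrm (vec d (\<lambda>i. if i < m then a i else 0)) \<le> (\<Sum>i<m. \<bar>a i\<bar> * nrm (unit_vec d i))"
  using assms(2)
proof (induction m)
  case 0
  have "vec d (\<lambda>i. if i < 0 then a i else 0) = 0\<^sub>v d"
    by (intro eq_vecI) auto
  then show ?case
    using is_norm_zero[OF assms(1)] by simp
next
  case (Suc m)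
  have "vec d (\<lambda>i. if i < Suc m then a i else 0)
      = vec d (\<lambda>i. if i < m then a i else 0) + a m \<cdot>\<^sub>v unit_vec d m"
    using Suc.prems by (intro eq_vecI) (auto simp: unit_vec_def less_Suc_eq)
  then have "nrm (vec d (\<lambda>i. if i < Suc m then a i else 0))
      \<le> nrm (vec d (\<lambda>i. if i < m then a i else 0)) + \<bar>a m\<bar> * nrm (unit_vec d m)"
    using is_norm_add[OF assms(1), of "vec d (\<lambda>i. if i < m then a i else 0)" "a m \<cdot>\<^sub>v unit_vec d m"]
      is_norm_smult[OF assms(1), of "unit_vec d m" "a m"] by simp
  with Suc show ?case by simp
qed

text \<open>By the reverse triangle inequality and the basis expansion, the norm changes by at most
  a finite weighted sum of coordinate changes. Vectors are encoded as sequences so that the product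
  topology, and with it Tychonoff compactness, applies.\<close>

lemma is_norm_continuous_coordinates:
  assumes "is_norm d nrm"
  shows "continuous_on S (\<lambda>a. nrm (vec d a))"
  unfolding continuous_on_def
proof
  fix a :: "nat \<Rightarrow> real"
  assume "a \<in> S"
  let ?g = "\<lambda>b. \<Sum>i<d. \<bar>b i - a i\<bar> * nrm (unit_vec d i)"
  have vec_d: "vec d (\<lambda>i. if i < d then h i else 0) = vec d h" for h :: "nat \<Rightarrow> real"
    by (intro eq_vecI) auto
  have le: "nrm (vec d b - vec d a) \<le> ?g b" for b
  proof -
    have "vec d b - vec d a = vec d (\<lambda>i. b i - a i)"
      by (intro eq_vecI) auto
    then show ?thesis
      using is_norm_le_sum_unit_vec[OF assms order_refl, of "\<lambda>i. b i - a i"] vec_d by simp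
  qed
  have bound: "\<bar>nrm (vec d b) - nrm (vec d a)\<bar> \<le> ?g b" for b
    using is_norm_triangle_minus[OF assms, of "vec d b" "vec d a" "0\<^sub>v d"]
      is_norm_triangle_minus[OF assms, of "vec d a" "vec d b" "0\<^sub>v d"]
      is_norm_minus_commute[OF assms, of "vec d a" "vec d b"] le[of b]
    by simp
  have cont: "continuous_on S ?g"
    by (intro continuous_intros continuous_on_subset[OF continuous_on_product_coordinates]) auto
  have "(?g \<longlongrightarrow> 0) (at a within S)"
    using cont \<open>a \<in> S\<close> by (force simp: continuous_on_def)
  then have "((\<lambda>b. nrm (vec d b) - nrm (vec d a)) \<longlongrightarrow> 0) (at a within S)"
    by (rule tendsto_0_le[where K = 1]) (auto intro!: always_eventually order_trans[OF bound])
  then show "((\<lambda>b. nrm (vec d b)) \<longlongrightarrow> nrm (vec d a)) (at a within S)"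
    by (simp add: LIM_zero_iff)
qed

text \<open>Compactness of the faces \<open>a\<^sub>j = 1\<close> of the cube makes all coordinates bounded on the unit ball.\<close>

lemma is_norm_coordinate_bound:
  assumes "is_norm d nrm"
  obtains M where "\<And>u i. u \<in> carrier_vec d \<Longrightarrow> i < d \<Longrightarrow> \<bar>u $ i\<bar> \<le> M * nrm u"
proof -
  \<comment> \<open>Coordinates from \<open>d\<close> on are pinned to 0, so every factor of the
    product over all naturals is compact. Coordinate \<open>j\<close> is pinned to 1, so no point of
    \<open>F j\<close> gives the zero vector and the minimum of the norm there is positive.\<close>
  define F :: "nat \<Rightarrow> (nat \<Rightarrow> real) set" where
    "F j = PiE UNIV (\<lambda>i. if i = j then {1} else if i < d then {-1..1} else {0})" for j
  have "\<exists>m>0. \<forall>a\<in>F j. m \<le> nrm (vec d a)" if "j < d" for j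
  proof -
    have "compactin (product_topology (\<lambda>_. euclidean) UNIV) (F j)"
      unfolding F_def compactin_PiE by auto
    then have "compact (F j)"
      by (simp add: euclidean_product_topology)
    moreover have "F j \<noteq> {}"
      by (simp add: F_def PiE_eq_empty_iff)
    ultimately obtain b where b: "b \<in> F j" "\<forall>a\<in>F j. nrm (vec d b) \<le> nrm (vec d a)"
      using continuous_attains_inf[OF _ _ is_norm_continuous_coordinates[OF assms], of "F j"]
      by metis
    have "b j = 1" using b(1) by (auto simp: F_def PiE_iff dest!: spec[of _ j])
    then have "vec d b \<noteq> 0\<^sub>v d"
      using that by (metis index_vec index_zero_vec(1) zero_neq_one)
    then have "nrm (vec d b) > 0"
      using is_norm_nonneg[OF assms, of "vec d b"] is_norm_eq_0[OF assms, of "vec d b"]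
      by fastforce
    with b show ?thesis by blast
  qed
  then obtain m where m: "\<And>j. j < d \<Longrightarrow> m j > 0"
    and le: "\<And>j a. j < d \<Longrightarrow> a \<in> F j \<Longrightarrow> m j \<le> nrm (vec d a)"
    by metis
  have "\<bar>u $ i\<bar> \<le> (\<Sum>j<d. 1 / m j) * nrm u" if u: "u \<in> carrier_vec d" and i: "i < d" for u i
  proof -
    \<comment> \<open>Dividing \<open>u\<close> by its coordinate of largest absolute value, say the
      \<open>j\<close>-th, puts it on the face \<open>F j\<close>. The sum of all
      \<open>1 / m j\<close> then serves every \<open>j\<close> at once.\<close>
    have "Max ((\<lambda>i. \<bar>u $ i\<bar>) ` {..<d}) \<in> (\<lambda>i. \<bar>u $ i\<bar>) ` {..<d}"
      using i by (intro Max_in) auto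
    then obtain j where j: "j < d" and "Max ((\<lambda>i. \<bar>u $ i\<bar>) ` {..<d}) = \<bar>u $ j\<bar>"
      by auto
    then have max: "\<bar>u $ i\<bar> \<le> \<bar>u $ j\<bar>" if "i < d" for i
      using that Max_ge[of "(\<lambda>i. \<bar>u $ i\<bar>) ` {..<d}" "\<bar>u $ i\<bar>"] by auto
    have "\<bar>u $ j\<bar> \<le> 1 / m j * nrm u"
    proof (cases "u $ j = 0")
      case True
      then show ?thesis
        using m[OF j] is_norm_nonneg[OF assms u] by simp
    next
      case False
      let ?a = "\<lambda>i. if i < d then u $ i / u $ j else 0"
      have "-1 \<le> u $ i / u $ j \<and> u $ i / u $ j \<le> 1" if "i < d" for i
      proof -
        have "\<bar>u $ i / u $ j\<bar> \<le> 1"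
          using max[OF that] False by (simp add: abs_divide)
        then show ?thesis by linarith
      qed
      then have "?a \<in> F j"
        using j False by (auto simp: F_def PiE_iff)
      then have "m j \<le> nrm (vec d ?a)"
        by (rule le[OF j])
      also have "vec d ?a = (1 / u $ j) \<cdot>\<^sub>v u"
        using u by (intro eq_vecI) auto
      also have "nrm \<dots> = nrm u / \<bar>u $ j\<bar>"
        using is_norm_smult[OF assms u, of "1 / u $ j"] by simp
      finally show ?thesis
        using False m[OF j] by (simp add: field_simps)
    qed
    also have "1 / m j \<le> (\<Sum>j<d. 1 / m j)"
      using j m by (intro member_le_sum) (auto intro: less_imp_le)
    finally show ?thesis
      using max[OF i] is_norm_nonneg[OF assms u] by (smt (verit) mult_right_mono)
  qed
  then show thesis by (rule that)
qed

text \<open>The supremum in \<open>dual_norm\<close> is an upper bound only once its set is known to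
  be bounded, which the coordinate bound provides. The rest is homogeneity: normalize
  \<open>u\<close> unless it is zero.\<close>

lemma scalar_prod_le_dual_norm:
  assumes "is_norm d nrm" "w \<in> carrier_vec d" "u \<in> carrier_vec d"
  shows "\<bar>w \<bullet> u\<bar> \<le> dual_norm d nrm w * nrm u"
proof -
  let ?S = "{\<bar>w \<bullet> v\<bar> | v. v \<in> carrier_vec d \<and> nrm v \<le> 1}"
  obtain M where M: "\<And>u i. u \<in> carrier_vec d \<Longrightarrow> i < d \<Longrightarrow> \<bar>u $ i\<bar> \<le> M * nrm u"
    using is_norm_coordinate_bound[OF assms(1)] by blast
  have "bdd_above ?S"
  proof (rule bdd_aboveI)
    fix s
    assume "s \<in> ?S"
    then obtain v where s: "s = \<bar>w \<bullet> v\<bar>" and v: "v \<in> carrier_vec d" "nrm v \<le> 1"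
      by blast
    have "\<bar>v $ i\<bar> \<le> \<bar>M\<bar>" if "i < d" for i
    proof -
      have "M * nrm v \<le> \<bar>M\<bar> * nrm v"
        using is_norm_nonneg[OF assms(1) v(1)] by (intro mult_right_mono) auto
      also have "\<dots> \<le> \<bar>M\<bar>"
        using v(2) by (intro mult_left_le) auto
      finally show ?thesis
        using M[OF v(1) that] by linarith
    qed
    then have "(\<Sum>i<d. \<bar>w $ i\<bar> * \<bar>v $ i\<bar>) \<le> (\<Sum>i<d. \<bar>w $ i\<bar> * \<bar>M\<bar>)"
      by (intro sum_mono mult_left_mono) auto
    moreover have "\<bar>w \<bullet> v\<bar> \<le> (\<Sum>i<d. \<bar>w $ i\<bar> * \<bar>v $ i\<bar>)"
      using v(1) sum_abs[of "\<lambda>i. w $ i * v $ i" "{..<d}"]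
      by (simp add: scalar_prod_def abs_mult lessThan_atLeast0)
    ultimately show "s \<le> (\<Sum>i<d. \<bar>w $ i\<bar> * \<bar>M\<bar>)"
      using s by linarith
  qed
  then have upper: "\<bar>w \<bullet> v\<bar> \<le> dual_norm d nrm w" if "v \<in> carrier_vec d" "nrm v \<le> 1" for v
    unfolding dual_norm_def using that by (intro cSup_upper) auto
  show ?thesis
  proof (cases "nrm u = 0")
    case True
    then have "u = 0\<^sub>v d"
      using is_norm_eq_0 assms by blast
    with True show ?thesis
      using assms by simp
  next
    case False
    then have pos: "nrm u > 0"
      using is_norm_nonneg[OF assms(1,3)] by simp
    then have "\<bar>w \<bullet> ((1 / nrm u) \<cdot>\<^sub>v u)\<bar> \<le> dual_norm d nrm w"
      using assms is_norm_smult[OF assms(1,3), of "1 / nrm u"] by (intro upper) auto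
    then show ?thesis
      using pos assms by (simp add: field_simps abs_mult)
  qed
qed

section \<open>Subgradients of a power of a norm\<close>

text \<open>Convexity of the power: its tangent at \<open>a\<close> lies below its graph. The mean
  value theorem gives this for positive arguments.\<close>

lemma powr_diff_le_tangent:
  fixes a b r :: real
  assumes "0 \<le> a" "0 \<le> b" "1 \<le> r"
  shows "a powr r - b powr r \<le> r * (a - b) * a powr (r - 1)"
proof (cases "a = 0 \<or> b = 0")
  \<comment> \<open>For \<open>a = 0\<close> the convention that \<open>0 powr s = 0\<close> for all
    \<open>s\<close>, even \<open>s = 0\<close>, makes the right side vanish.\<close>
  case True
  have "a * a powr (r - 1) = a powr r"
    using assms by (simp add: powr_mult_base)
  moreover have "a powr r \<le> r * a powr r"
    using assms mult_right_mono[of 1 r "a powr r"] by simp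
  ultimately show ?thesis
    using True by (auto simp: mult.assoc)
next
  case False
  then have pos: "a > 0" "b > 0" using assms by auto
  have der: "((\<lambda>z. z powr r) has_real_derivative r * z powr (r - 1)) (at z)" if "z > 0" for z
    using has_real_derivative_powr[OF that] .
  consider "a = b" | "b < a" | "a < b" by linarith
  then show ?thesis
  proof cases
    case 1
    then show ?thesis by simp
  next
    case 2
    then obtain z where z: "b < z" "z < a"
      "a powr r - b powr r = (a - b) * (r * z powr (r - 1))"
      using MVT2[of b a "\<lambda>z. z powr r" "\<lambda>z. r * z powr (r - 1)"] der pos by force
    moreover have "z powr (r - 1) \<le> a powr (r - 1)"
      using z pos assms by (intro powr_mono2) auto
    ultimately show ?thesis
      using 2 assms by (simp add: mult_left_mono mult.left_commute mult.assoc)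
  next
    case 3
    then obtain z where z: "a < z" "z < b"
      "b powr r - a powr r = (b - a) * (r * z powr (r - 1))"
      using MVT2[of a b "\<lambda>z. z powr r" "\<lambda>z. r * z powr (r - 1)"] der pos by force
    moreover have "a powr (r - 1) \<le> z powr (r - 1)"
      using z pos assms by (intro powr_mono2) auto
    ultimately have "(b - a) * (r * a powr (r - 1)) \<le> b powr r - a powr r"
      using 3 assms by (simp add: mult_left_mono)
    then show ?thesis by (simp add: algebra_simps)
  qed
qed

text \<open>Test the subgradient inequality at \<open>y + t u\<close>, bound the increase of the
  power by the triangle inequality and the tangent, divide by \<open>t\<close> and let
  \<open>t\<close> tend to 0. As \<open>u\<close> is arbitrary, this is the dual norm bound on
  \<open>g\<close>.\<close>

lemma powr_subgradient_le:
  assumes nrm: "is_norm d nrm" and "1 < r" "0 < lam"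
    and x: "x \<in> carrier_vec d" and y: "y \<in> carrier_vec d" and u: "u \<in> carrier_vec d"
    and g: "g \<in> subdiff d 0 (\<lambda>z. 1 / (r * lam) * nrm (z - x) powr r) y"
  shows "g \<bullet> u \<le> nrm (y - x) powr (r - 1) / lam * nrm u"
proof -
  let ?D = "nrm (y - x)"
  have D: "?D \<ge> 0" and nu: "nrm u \<ge> 0"
    using is_norm_nonneg[OF nrm] x y u by auto
  have gc: "g \<in> carrier_vec d" using g by (simp add: subdiff_def)
  have ev: "g \<bullet> u \<le> (?D + t * nrm u) powr (r - 1) / lam * nrm u" if t: "t > 0" for t
  proof -
    have "1 / (r * lam) * nrm (y + t \<cdot>\<^sub>v u - x) powr r
        \<ge> 1 / (r * lam) * ?D powr r + g \<bullet> (y + t \<cdot>\<^sub>v u - y)"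
      using g y u unfolding subdiff_def by auto
    moreover have "y + t \<cdot>\<^sub>v u - y = t \<cdot>\<^sub>v u"
      using y u by (intro eq_vecI) auto
    moreover have "nrm (y + t \<cdot>\<^sub>v u - x) powr r \<le> (?D + t * nrm u) powr r"
    proof (rule powr_mono2)
      have "y + t \<cdot>\<^sub>v u - x = (y - x) + t \<cdot>\<^sub>v u"
        using x y u by (intro eq_vecI) auto
      then show "nrm (y + t \<cdot>\<^sub>v u - x) \<le> ?D + t * nrm u"
        using is_norm_add[OF nrm, of "y - x" "t \<cdot>\<^sub>v u"] is_norm_smult[OF nrm u, of t] x y u t by simp
      show "0 \<le> nrm (y + t \<cdot>\<^sub>v u - x)"
        using is_norm_nonneg[OF nrm] x y u by auto
    qed (use assms in simp)
    ultimately have "t * (g \<bullet> u) \<le> 1 / (r * lam) * ((?D + t * nrm u) powr r - ?D powr r)"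
      using assms gc u mult_left_mono[of "nrm (y + t \<cdot>\<^sub>v u - x) powr r" "(?D + t * nrm u) powr r"
          "1 / (r * lam)"]
      by (simp add: right_diff_distrib)
    also have "\<dots> \<le> 1 / (r * lam) * (r * (t * nrm u) * (?D + t * nrm u) powr (r - 1))"
      using powr_diff_le_tangent[of "?D + t * nrm u" ?D r] assms D nu t
      by (intro mult_left_mono) auto
    also have "\<dots> = t * ((?D + t * nrm u) powr (r - 1) / lam * nrm u)"
      using assms by simp
    finally show ?thesis
      using t by (rule mult_left_le_imp_le)
  qed
  \<comment> \<open>If \<open>?D = 0\<close>, the base tends to 0; the power still converges because
    the exponent \<open>r - 1\<close> is positive.\<close>
  have "((\<lambda>t. (?D + t * nrm u) powr (r - 1) / lam * nrm u)
      \<longlongrightarrow> (?D + 0 * nrm u) powr (r - 1) / lam * nrm u) (at_right 0)"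
    using assms D nu
    by (intro tendsto_intros tendsto_powr') (auto simp: eventually_at_right_less intro!: eventually_at_rightI[of 0 1])
  then have "g \<bullet> u \<le> (?D + 0 * nrm u) powr (r - 1) / lam * nrm u"
    by (rule tendsto_lowerbound) (use ev in \<open>auto intro!: eventually_at_rightI[of 0 1]\<close>)
  then show ?thesis by simp
qed

text \<open>Moving from \<open>y\<close> towards \<open>x\<close> by a fraction \<open>t\<close>
  scales the distance by exactly \<open>1 - t\<close>, so the decrease of the power is explicit. The
  tangent at \<open>1 - t\<close> bounds it below, and \<open>t\<close> tending to 0 gives one half
  of the Euler relation for homogeneous functions.\<close>

lemma powr_subgradient_radial_ge:
  assumes nrm: "is_norm d nrm" and "1 < r" "0 < lam"
    and x: "x \<in> carrier_vec d" and y: "y \<in> carrier_vec d"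
    and g: "g \<in> subdiff d 0 (\<lambda>z. 1 / (r * lam) * nrm (z - x) powr r) y"
  shows "nrm (y - x) powr r / lam \<le> g \<bullet> (y - x)"
proof -
  let ?D = "nrm (y - x)"
  have D: "?D \<ge> 0"
    using is_norm_nonneg[OF nrm] x y by auto
  have gc: "g \<in> carrier_vec d" using g by (simp add: subdiff_def)
  have ev: "?D powr r * (1 - t) powr (r - 1) / lam \<le> g \<bullet> (y - x)" if t: "t > 0" "t < 1" for t
  proof -
    have "1 / (r * lam) * nrm (y + (- t) \<cdot>\<^sub>v (y - x) - x) powr r
        \<ge> 1 / (r * lam) * ?D powr r + g \<bullet> (y + (- t) \<cdot>\<^sub>v (y - x) - y)"
      using g x y unfolding subdiff_def by auto
    moreover have "y + (- t) \<cdot>\<^sub>v (y - x) - y = (- t) \<cdot>\<^sub>v (y - x)"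
      using x y by (intro eq_vecI) auto
    moreover have "y + (- t) \<cdot>\<^sub>v (y - x) - x = (1 - t) \<cdot>\<^sub>v (y - x)"
      using x y by (intro eq_vecI) (auto simp: algebra_simps)
    moreover have "nrm ((1 - t) \<cdot>\<^sub>v (y - x)) powr r = (1 - t) powr r * ?D powr r"
      using is_norm_smult[OF nrm, of "y - x" "1 - t"] x y t D by (simp add: powr_mult)
    moreover have "g \<bullet> ((- t) \<cdot>\<^sub>v (y - x)) = - t * (g \<bullet> (y - x))"
      using gc x y by (intro scalar_prod_smult_distrib) auto
    ultimately have "1 / (r * lam) * ((1 - (1 - t) powr r) * ?D powr r) \<le> t * (g \<bullet> (y - x))"
      by (simp only:) (simp add: algebra_simps)
    moreover have "r * t * (1 - t) powr (r - 1) \<le> 1 - (1 - t) powr r"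
      using powr_diff_le_tangent[of "1 - t" 1 r] assms t by simp
    then have "1 / (r * lam) * ((r * t * (1 - t) powr (r - 1)) * ?D powr r)
        \<le> 1 / (r * lam) * ((1 - (1 - t) powr r) * ?D powr r)"
      using assms by (intro mult_left_mono mult_right_mono) auto
    ultimately have "t * (?D powr r * (1 - t) powr (r - 1) / lam) \<le> t * (g \<bullet> (y - x))"
      using assms by (simp add: mult_ac)
    then show ?thesis
      using t(1) by (rule mult_left_le_imp_le)
  qed
  have "((\<lambda>t. ?D powr r * (1 - t) powr (r - 1) / lam)
      \<longlongrightarrow> ?D powr r * (1 - 0) powr (r - 1) / lam) (at_right 0)"
    using assms by (intro tendsto_intros) auto
  then have "?D powr r * (1 - 0) powr (r - 1) / lam \<le> g \<bullet> (y - x)"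
    by (rule tendsto_upperbound) (use ev in \<open>auto intro!: eventually_at_rightI[of 0 1]\<close>)
  then show ?thesis by simp
qed

text \<open>Up to a dual error, \<open>v\<close> is \<open>- g\<close>, whose radial part yields a
  gain of \<open>D powr r / lam\<close>, with \<open>D\<close> the step length. The errors in
  \<open>v\<close> and in \<epsilon> consume the shares \<sigma> and \<sigma>' of this gain.\<close>

lemma prox_oracle_step:
  assumes nrm: "is_norm d nrm" and "1 < r" "0 < lam" "0 \<le> \<sigma>"
    and x: "x \<in> carrier_vec d" and z: "z \<in> carrier_vec d"
    and prox: "prox_oracle d nrm f r \<sigma> \<sigma>' x lam y v"
  shows "f y - f z \<le> (1 + \<sigma>) / lam * nrm (x - y) powr (r - 1) * nrm (x - z)
           - (1 - \<sigma> - \<sigma>') / lam * nrm (x - y) powr r"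
proof -
  let ?D = "nrm (x - y)"
  obtain \<epsilon> g where y: "y \<in> carrier_vec d" and v: "v \<in> subdiff d \<epsilon> f y"
    and \<epsilon>: "\<epsilon> \<le> \<sigma>' / lam * ?D powr r"
    and g: "g \<in> subdiff d 0 (\<lambda>z. 1 / (r * lam) * nrm (z - x) powr r) y"
    and dual: "dual_norm d nrm (v - (- g)) \<le> \<sigma> / lam * ?D powr (r - 1)"
    using prox unfolding prox_oracle_def by blast
  have D: "nrm (y - x) = ?D" and zx: "nrm (z - x) = nrm (x - z)"
    using is_norm_minus_commute[OF nrm] x y z by auto
  have D0: "?D \<ge> 0" and xz0: "nrm (x - z) \<ge> 0" and yz0: "nrm (y - z) \<ge> 0"
    using is_norm_nonneg[OF nrm] x y z by auto
  have vc: "v \<in> carrier_vec d" and gc: "g \<in> carrier_vec d"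
    using v g by (auto simp: subdiff_def)
  have "f z \<ge> f y + v \<bullet> (z - y) - \<epsilon>"
    using v z unfolding subdiff_def by auto
  \<comment> \<open>Write \<open>v\<close> as \<open>(v + g) - g\<close> and split
    \<open>z - y\<close> at \<open>x\<close> in the part of \<open>g\<close>. The three terms are
    handled by the dual norm, the radial bound and the bound on \<open>g\<close> in the direction
    \<open>z - x\<close>.\<close>
  moreover have "v \<bullet> (z - y) = - ((v - (- g)) \<bullet> (y - z)) + g \<bullet> (y - x) - g \<bullet> (z - x)"
    using vc gc x y z
    by (simp add: minus_scalar_prod_distrib[of _ d] scalar_prod_minus_distrib[of _ d]
        add_scalar_prod_distrib[of _ d])
  moreover have "(v - (- g)) \<bullet> (y - z) \<le> \<sigma> / lam * ?D powr (r - 1) * (?D + nrm (x - z))"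
  proof -
    have "(v - (- g)) \<bullet> (y - z) \<le> dual_norm d nrm (v - (- g)) * nrm (y - z)"
      using scalar_prod_le_dual_norm[OF nrm, of "v - (- g)" "y - z"] vc gc y z by simp
    also have "\<dots> \<le> \<sigma> / lam * ?D powr (r - 1) * nrm (y - z)"
      using dual yz0 by (rule mult_right_mono)
    also have "\<dots> \<le> \<sigma> / lam * ?D powr (r - 1) * (?D + nrm (x - z))"
      using is_norm_triangle_minus[OF nrm y x z] D assms by (intro mult_left_mono) auto
    finally show ?thesis .
  qed
  moreover have "?D powr (r - 1) * ?D = ?D powr r"
    using D0 by (simp add: powr_mult_base mult.commute)
  moreover have "g \<bullet> (z - x) \<le> ?D powr (r - 1) / lam * nrm (x - z)"
    using powr_subgradient_le[OF nrm assms(2,3) x y _ g, of "z - x"] x z D zx by simp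
  moreover have "?D powr r / lam \<le> g \<bullet> (y - x)"
    using powr_subgradient_radial_ge[OF nrm assms(2,3) x y g] D by simp
  ultimately have "f y - f z \<le> \<sigma> / lam * (?D powr r + ?D powr (r - 1) * nrm (x - z))
      - ?D powr r / lam + ?D powr (r - 1) / lam * nrm (x - z) + \<sigma>' / lam * ?D powr r"
    using \<epsilon> by (simp add: distrib_left mult.assoc)
  also have "\<dots> = (1 + \<sigma>) / lam * ?D powr (r - 1) * nrm (x - z)
           - (1 - \<sigma> - \<sigma>') / lam * ?D powr r"
    using assms by (simp add: field_simps)
  finally show ?thesis .
qed

section \<open>The rate\<close>

text \<open>On the unit interval a convex function lies below its chord. Used with
  \<open>u = 1 / k\<close> to compare the rates at \<open>k\<close> and
  \<open>k + 1\<close>.\<close>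

lemma one_plus_power_le:
  fixes u :: real
  assumes "0 \<le> u" "u \<le> 1"
  shows "(1 + u) ^ n \<le> 1 + (2 ^ n - 1) * u"
proof (induction n)
  case (Suc n)
  have "(1 + u) ^ Suc n \<le> (1 + (2 ^ n - 1) * u) * (1 + u)"
    using Suc assms by (simp add: mult_right_mono mult.commute)
  also have "\<dots> = 1 + u + (2 ^ n - 1) * u + (2 ^ n - 1) * (u * u)"
    by (simp add: algebra_simps)
  also have "(2 ^ n - 1) * (u * u) \<le> (2 ^ n - 1) * u"
    using assms mult_left_mono[of u 1 u] by (intro mult_left_mono) auto
  finally show ?case
    by (simp add: algebra_simps)
qed simp

text \<open>Suppose the value after step \<open>k\<close> exceeded \<open>K / k powr p\<close>. Then
  \<open>gap\<close> forces \<open>D k\<close> above \<open>B R / k\<close>. For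
  \<open>k = 1\<close> this contradicts \<open>gap\<close> itself; for later \<open>k\<close> the
  drop is so large that the previous value would violate the induction hypothesis.\<close>

lemma descent_rate:
  fixes \<delta> D :: "nat \<Rightarrow> real" and A L R B c p :: real
  assumes "0 < A" "0 < L" "0 \<le> R" "0 < c" "0 < p" "p \<le> real n"
    and B: "2 ^ (n + 1) * A \<le> c * B"
    and D: "\<And>k. 1 \<le> k \<Longrightarrow> k \<le> T \<Longrightarrow> 0 \<le> D k"
    and gap: "\<And>k. 1 \<le> k \<Longrightarrow> k \<le> T \<Longrightarrow>
        \<delta> (Suc k) \<le> A * L * R * D k powr p - c * L * D k powr (p + 1)"
    and drop: "\<And>k. 1 \<le> k \<Longrightarrow> k \<le> T \<Longrightarrow> \<delta> (Suc k) \<le> \<delta> k - c * L * D k powr (p + 1)"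
    and "1 \<le> T"
  shows "\<delta> (Suc T) \<le> A * B powr p * (L * R powr (p + 1) / real T powr p)"
proof -
  \<comment> \<open>The value of \<open>A * L * R * D powr p\<close> at \<open>D = B * R\<close>; at
    \<open>D = B * R / m\<close> it becomes \<open>K / m powr p\<close>.\<close>
  define K where "K = A * B powr p * (L * R powr (p + 1))"
  have "0 < c * B"
    using B \<open>0 < A\<close> by (smt (verit) mult_pos_pos zero_less_power)
  then have Bpos: "0 < B"
    using \<open>0 < c\<close> by (simp add: zero_less_mult_iff)
  have K0: "0 \<le> K"
    unfolding K_def using assms by simp
  have Rp: "R * R powr p = R powr (p + 1)"
    using assms by (simp add: powr_mult_base add.commute)
  have long_step: "B * R / real m < D k"
    if k: "1 \<le> k" "k \<le> T" and m: "1 \<le> m" and big: "K / real m powr p < \<delta> (Suc k)" for k m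
  proof (rule ccontr)
    assume "\<not> B * R / real m < D k"
    then have "D k powr p \<le> (B * R / real m) powr p"
      using D[OF k] assms by (intro powr_mono2) auto
    then have "A * L * R * D k powr p \<le> A * L * R * (B * R / real m) powr p"
      using assms by (intro mult_left_mono) auto
    also have "(B * R / real m) powr p = B powr p * R powr p / real m powr p"
      using assms Bpos by (simp add: powr_mult powr_divide)
    also have "A * L * R * (B powr p * R powr p / real m powr p) = K / real m powr p"
      unfolding K_def Rp[symmetric] by simp
    finally show False
      using gap[OF k] big assms by (smt (verit) mult_nonneg_nonneg powr_ge_zero)
  qed
  have "1 \<le> k \<Longrightarrow> k \<le> T \<Longrightarrow> \<delta> (Suc k) \<le> K / real k powr p" for k
  proof (induction k rule: nat_induct_at_least)
    case base
    show ?case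
    \<comment> \<open>Nothing bounds \<delta> at 1, so \<open>drop\<close> does not help here. Since
      \<open>A \<le> c * B\<close>, a step longer than \<open>B * R\<close> makes the right side of
      \<open>gap\<close> nonpositive.\<close>
    proof (rule ccontr)
      assume "\<not> ?thesis"
      then have less: "B * R < D 1" and pos: "0 < \<delta> (Suc 1)"
        using long_step[of 1 1] base K0 by auto
      have "2 ^ (n + 1) * A \<ge> 1 * A"
        using assms(1) one_le_power[of "2::real" "n + 1"] by (intro mult_right_mono) auto
      then have "A \<le> c * B"
        using B by linarith
      then have "A * R \<le> c * B * R"
        using assms by (intro mult_right_mono) auto
      also have "\<dots> \<le> c * D 1"
        using less assms by simp
      finally have "(A * R) * (L * D 1 powr p) \<le> (c * D 1) * (L * D 1 powr p)"
        using assms by (intro mult_right_mono) auto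
      moreover have "D 1 * D 1 powr p = D 1 powr (p + 1)"
        using D[of 1] base by (simp add: powr_mult_base add.commute)
      ultimately have "A * L * R * D 1 powr p \<le> c * L * D 1 powr (p + 1)"
        by (simp add: mult_ac)
      then show False
        using gap[of 1] base pos by simp
    qed
  next
    case (Suc k)
    let ?m = "real (Suc k)"
    have IH: "\<delta> (Suc k) \<le> K / real k powr p"
      using Suc by simp
    show ?case
    proof (rule ccontr)
      assume "\<not> ?thesis"
      then have big: "K / ?m powr p < \<delta> (Suc (Suc k))"
        by simp
      then have less: "B * R / ?m < D (Suc k)"
        using long_step[of "Suc k" "Suc k"] Suc.prems by simp
      have "(B * R / ?m) powr (p + 1) \<le> D (Suc k) powr (p + 1)"
        using less assms Bpos by (intro powr_mono2) auto
      moreover have "(B * R / ?m) powr (p + 1) = B * B powr p * R powr (p + 1) / (?m * ?m powr p)"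
        using assms(3) Bpos by (simp add: powr_mult powr_divide powr_add mult_ac)
      ultimately have "c * L * (B * B powr p * R powr (p + 1) / (?m * ?m powr p))
          \<le> c * L * D (Suc k) powr (p + 1)"
        using assms by (intro mult_left_mono) auto
      \<comment> \<open>The guaranteed drop, relative to the target \<open>K / ?m powr p\<close>, is
        \<open>c * B / A / ?m\<close>.\<close>
      moreover have "c * L * (B * B powr p * R powr (p + 1) / (?m * ?m powr p))
          = K / ?m powr p * (c * B / A / ?m)"
        unfolding K_def using \<open>0 < A\<close> by (simp add: mult_ac)
      moreover have "K / ?m powr p * (2 ^ n / real k) \<le> K / ?m powr p * (c * B / A / ?m)"
      proof (intro mult_left_mono)
        \<comment> \<open>Here \<open>k + 1 \<le> 2 * k\<close>; this is what the extra factor 2 in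
          the condition on \<open>B\<close> pays for.\<close>
        have "2 ^ n / real k \<le> 2 ^ (n + 1) / ?m"
          using Suc.hyps by (simp add: field_simps)
        also have "\<dots> \<le> c * B / A / ?m"
          using B assms by (intro divide_right_mono) (simp_all add: field_simps)
        finally show "2 ^ n / real k \<le> c * B / A / ?m" .
      qed (use K0 in simp)
      ultimately have "K / ?m powr p * (1 + 2 ^ n / real k) < \<delta> (Suc k)"
        using drop[of "Suc k"] big Suc.prems by (simp add: distrib_left)
      moreover have "K / ?m powr p * (?m / real k) powr p \<le> K / ?m powr p * (1 + 2 ^ n / real k)"
      proof (intro mult_left_mono)
        \<comment> \<open>Rounding the exponent up to the integer \<open>n\<close> makes the chord
          bound applicable.\<close>
        have "(?m / real k) powr p \<le> (?m / real k) powr real n"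
          using assms Suc.hyps by (intro powr_mono) auto
        also have "\<dots> = (1 + 1 / real k) ^ n"
          using Suc.hyps by (simp add: powr_realpow field_simps)
        also have "\<dots> \<le> 1 + (2 ^ n - 1) * (1 / real k)"
          using Suc.hyps by (intro one_plus_power_le) auto
        also have "\<dots> \<le> 1 + 2 ^ n / real k"
          by (simp add: divide_right_mono)
        finally show "(?m / real k) powr p \<le> 1 + 2 ^ n / real k" .
      qed (use K0 in simp)
      moreover have "K / ?m powr p * (?m / real k) powr p = K / real k powr p"
        by (simp add: powr_divide)
      ultimately show False
        using IH by simp
    qed
  qed
  from this[of T] show ?thesis
    using \<open>1 \<le> T\<close> by (simp add: K_def)
qed

section \<open>The bound for the iterates of the algorithm\<close>

theorem theorem23:
  fixes q :: nat and \<nu> \<sigma> \<sigma>' :: real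
  assumes "q \<ge> 1" and "0 < \<nu>" and "\<nu> \<le> 1"
    and "0 \<le> \<sigma>" and "\<sigma> < 1/2" and "0 \<le> \<sigma>'" and "\<sigma>' < 1/2"
  shows "\<exists>C>0. \<forall>(d::nat) (nrm :: real vec \<Rightarrow> real) (f :: real vec \<Rightarrow> real) (L::real) (xstar :: real vec)
           (x :: nat \<Rightarrow> real vec) (v :: nat \<Rightarrow> real vec) (T::nat) (R::real).
           is_norm d nrm \<and> convex_fun d f \<and> is_minimizer d f xstar \<and>
           L > 0 \<and> holder_deriv d nrm f q L \<nu> \<and>
           x 0 \<in> carrier_vec d \<and>
           (\<forall>k\<le>T. prox_oracle d nrm f (real q + \<nu>) \<sigma> \<sigma>' (x k) (1 / L) (x (Suc k)) (v k)) \<and>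
           T \<ge> 1 \<and> Max ((\<lambda>k. nrm (x k - xstar)) ` {1..T}) \<le> R
           \<longrightarrow> f (x (T + 1)) - f xstar
                 \<le> C * (L * R powr (real q + \<nu>) / real T powr (real q + \<nu> - 1))"
proof -
  define c where "c = 1 - \<sigma> - \<sigma>'"
  \<comment> \<open>Equality in the condition of \<open>descent_rate\<close> with
    \<open>n = q\<close>, which dominates the exponent \<open>q + \<nu> - 1\<close> since
    \<open>\<nu> \<le> 1\<close>. The constant is fixed before the dimension, the norm and the
    function.\<close>
  define B where "B = 2 ^ (q + 1) * (1 + \<sigma>) / c"
  let ?p = "real q + \<nu> - 1"
  have c: "c > 0" using assms by (simp add: c_def)
  then have B: "B > 0" using assms by (simp add: B_def)
  show ?thesis
  proof (intro exI[of _ "(1 + \<sigma>) * B powr ?p"] conjI allI impI)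
    show "0 < (1 + \<sigma>) * B powr ?p"
      using assms B by simp
  next
    fix d nrm f L xstar x v T R
    assume "is_norm d nrm \<and> convex_fun d f \<and> is_minimizer d f xstar \<and>
           L > 0 \<and> holder_deriv d nrm f q L \<nu> \<and>
           x 0 \<in> carrier_vec d \<and>
           (\<forall>k\<le>T. prox_oracle d nrm f (real q + \<nu>) \<sigma> \<sigma>' (x k) (1 / L) (x (Suc k)) (v k)) \<and>
           T \<ge> 1 \<and> Max ((\<lambda>k. nrm (x k - xstar)) ` {1..T}) \<le> R"
    then have nrm: "is_norm d nrm" and star: "xstar \<in> carrier_vec d" and L: "L > 0"
      and x0: "x 0 \<in> carrier_vec d" and T: "T \<ge> 1"
      and prox: "\<And>k. k \<le> T \<Longrightarrow>
        prox_oracle d nrm f (real q + \<nu>) \<sigma> \<sigma>' (x k) (1 / L) (x (Suc k)) (v k)"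
      and Max: "Max ((\<lambda>k. nrm (x k - xstar)) ` {1..T}) \<le> R"
      by (auto simp: is_minimizer_def)
    have xc: "x k \<in> carrier_vec d" if "k \<le> Suc T" for k
      using that x0 prox[of "k - 1"] by (cases k) (auto simp: prox_oracle_def)
    have R: "nrm (x k - xstar) \<le> R" if "1 \<le> k" "k \<le> T" for k
      using Max that by (subst (asm) Max_le_iff) auto
    have R0: "R \<ge> 0"
      using R[of 1] T is_norm_nonneg[OF nrm, of "x 1 - xstar"] xc[of 1] star by simp
    have step: "f (x (Suc k)) - f z
        \<le> (1 + \<sigma>) * L * nrm (x k - z) * nrm (x k - x (Suc k)) powr ?p
          - c * L * nrm (x k - x (Suc k)) powr (?p + 1)"
      if "k \<le> T" "z \<in> carrier_vec d" for k z
      using prox_oracle_step[OF nrm _ _ _ xc that(2) prox[OF that(1)]] that assms L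
      by (simp add: c_def mult_ac)
    have "f (x (Suc T)) - f xstar
        \<le> (1 + \<sigma>) * B powr ?p * (L * R powr (?p + 1) / real T powr ?p)"
    \<comment> \<open>Only steps from iterates of index 1 to \<open>T\<close> enter, those within
      distance \<open>R\<close> of the minimizer; this is why the rate in \<open>T\<close> is
      reached after \<open>T + 1\<close> iterations.\<close>
    proof (rule descent_rate[where \<delta> = "\<lambda>k. f (x k) - f xstar" and n = q
          and D = "\<lambda>k. nrm (x k - x (Suc k))" and c = c])
      fix k
      assume k: "1 \<le> k" "k \<le> T"
      let ?D = "nrm (x k - x (Suc k))"
      show "0 \<le> ?D"
        using is_norm_nonneg[OF nrm] xc k by simp
      have "(1 + \<sigma>) * L * nrm (x k - xstar) * ?D powr ?p \<le> (1 + \<sigma>) * L * R * ?D powr ?p"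
        using R[OF k] L assms by (intro mult_left_mono mult_right_mono) auto
      then show "f (x (Suc k)) - f xstar \<le> (1 + \<sigma>) * L * R * ?D powr ?p - c * L * ?D powr (?p + 1)"
        using step[of k xstar] k star by simp
      \<comment> \<open>With \<open>z = x k\<close> the positive term of the step inequality
        vanishes, leaving the pure decrease.\<close>
      have "nrm (x k - x k) = 0"
        using xc[of k] k is_norm_zero[OF nrm] by simp
      then show "f (x (Suc k)) - f xstar \<le> f (x k) - f xstar - c * L * ?D powr (?p + 1)"
        using step[of k "x k"] k xc[of k] by simp
    qed (use assms L R0 c T in \<open>simp_all add: B_def\<close>)
    then show "f (x (T + 1)) - f xstar
        \<le> (1 + \<sigma>) * B powr ?p * (L * R powr (real q + \<nu>) / real T powr ?p)"
      by simp
  qed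
qed

end
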